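(* The category of locally finite MV-algebras is not equivalent (as a category) to any variety of finitary algebras.
   Context: MV-algebras: an MV-algebra is an algebra $\langle A,\oplus,\neg,0\rangle$ such that $\langle A,\oplus,0\rangle$ is a monoid, $\neg\neg x=x$, $\neg 0\oplus x=\neg 0$, and $\neg(\neg x\oplus y)\oplus y=\neg(\neg y\oplus x)\oplus x$. An MV-algebra is locally finite if each of its finitely generated subalgebras is finite. The category of locally finite MV-algebras has all locally finite MV-algebras as objects and all MV-homomorphisms between them as arrows. Varieties: a (one-sorted) signature $\Sigma$ is a (possibly large) class of operation symbols, each with an arity. A variety of $\Sigma$-algebras is a class of $\Sigma$-algebras that can be presented by a class of (universally quantified) equations and that has free algebras over every set; it is regarded as a category with all homomorphisms. It is a variety of finitary algebras if all operation symbols in $\Sigma$ have finite arity. *)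

theory Defs
  imports "HOL-Algebra.Group" "HOL-Library.Equipollence"
begin

section \<open>Sets and classes\<close>

text \<open>
  HOL has no type of all sets. A type \<open>'u\<close> plays the role of the set-theoretic universe: all
  carriers are subsets of \<open>'u\<close>, an arbitrary subset of \<open>'u\<close> is a class, and, by the principle of
  limitation of size, a class is a set iff it is not equinumerous with the universe.
  If the cardinality of \<open>'u\<close> is inaccessible, then these are the sets and classes of a Grothendieck
  universe, up to bijections of the carriers.
\<close>

definition is_set :: "'u set \<Rightarrow> bool" where
  "is_set X \<longleftrightarrow> X \<prec> (UNIV :: 'u set)"


section \<open>Categories\<close>

text \<open>
  \<open>Comp C a b c g f\<close> is the composite of \<open>f : a \<rightarrow> b\<close> and \<open>g : b \<rightarrow> c\<close>. Hom-sets for different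
  pairs of objects need not be disjoint, so composition takes the objects as arguments.
\<close>

record ('o, 'm) cat =
  Ob :: "'o set"
  Hom :: "'o \<Rightarrow> 'o \<Rightarrow> 'm set"
  Ident :: "'o \<Rightarrow> 'm"
  Comp :: "'o \<Rightarrow> 'o \<Rightarrow> 'o \<Rightarrow> 'm \<Rightarrow> 'm \<Rightarrow> 'm"

locale category =
  fixes C :: "('o, 'm) cat"
  assumes Ident_in_Hom: "a \<in> Ob C \<Longrightarrow> Ident C a \<in> Hom C a a"
    and Comp_in_Hom:
      "\<lbrakk>a \<in> Ob C; b \<in> Ob C; c \<in> Ob C; f \<in> Hom C a b; g \<in> Hom C b c\<rbrakk>
        \<Longrightarrow> Comp C a b c g f \<in> Hom C a c"
    and Comp_Ident:
      "\<lbrakk>a \<in> Ob C; b \<in> Ob C; f \<in> Hom C a b\<rbrakk> \<Longrightarrow> Comp C a a b f (Ident C a) = f"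
    and Ident_Comp:
      "\<lbrakk>a \<in> Ob C; b \<in> Ob C; f \<in> Hom C a b\<rbrakk> \<Longrightarrow> Comp C a b b (Ident C b) f = f"
    and Comp_assoc:
      "\<lbrakk>a \<in> Ob C; b \<in> Ob C; c \<in> Ob C; d \<in> Ob C;
        f \<in> Hom C a b; g \<in> Hom C b c; h \<in> Hom C c d\<rbrakk>
        \<Longrightarrow> Comp C a b d (Comp C b c d h g) f = Comp C a c d h (Comp C a b c g f)"

definition iso_in :: "('o, 'm) cat \<Rightarrow> 'o \<Rightarrow> 'o \<Rightarrow> 'm \<Rightarrow> bool" where
  "iso_in C a b f \<longleftrightarrow> f \<in> Hom C a b \<and>
     (\<exists>g\<in>Hom C b a. Comp C a b a g f = Ident C a \<and> Comp C b a b f g = Ident C b)"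

record ('o, 'm, 'p, 'n) fctr =
  on_ob :: "'o \<Rightarrow> 'p"
  on_hom :: "'o \<Rightarrow> 'o \<Rightarrow> 'm \<Rightarrow> 'n"

definition is_functor :: "('o, 'm) cat \<Rightarrow> ('p, 'n) cat \<Rightarrow> ('o, 'm, 'p, 'n) fctr \<Rightarrow> bool" where
  "is_functor C D F \<longleftrightarrow>
     (\<forall>a\<in>Ob C. on_ob F a \<in> Ob D) \<and>
     (\<forall>a\<in>Ob C. \<forall>b\<in>Ob C. \<forall>f\<in>Hom C a b. on_hom F a b f \<in> Hom D (on_ob F a) (on_ob F b)) \<and>
     (\<forall>a\<in>Ob C. on_hom F a a (Ident C a) = Ident D (on_ob F a)) \<and>
     (\<forall>a\<in>Ob C. \<forall>b\<in>Ob C. \<forall>c\<in>Ob C. \<forall>f\<in>Hom C a b. \<forall>g\<in>Hom C b c.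
        on_hom F a c (Comp C a b c g f) =
        Comp D (on_ob F a) (on_ob F b) (on_ob F c) (on_hom F b c g) (on_hom F a b f))"

definition id_fctr :: "('o, 'm, 'o, 'm) fctr" where
  "id_fctr = \<lparr>on_ob = (\<lambda>a. a), on_hom = (\<lambda>a b f. f)\<rparr>"

definition comp_fctr ::
    "('p, 'n, 'q, 'k) fctr \<Rightarrow> ('o, 'm, 'p, 'n) fctr \<Rightarrow> ('o, 'm, 'q, 'k) fctr" where
  "comp_fctr G F =
     \<lparr>on_ob = (\<lambda>a. on_ob G (on_ob F a)),
      on_hom = (\<lambda>a b f. on_hom G (on_ob F a) (on_ob F b) (on_hom F a b f))\<rparr>"

definition naturally_isomorphic ::
    "('o, 'm) cat \<Rightarrow> ('p, 'n) cat \<Rightarrow>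
     ('o, 'm, 'p, 'n) fctr \<Rightarrow> ('o, 'm, 'p, 'n) fctr \<Rightarrow> bool" where
  "naturally_isomorphic C D F G \<longleftrightarrow>
     (\<exists>\<eta>. (\<forall>a\<in>Ob C. iso_in D (on_ob F a) (on_ob G a) (\<eta> a)) \<and>
          (\<forall>a\<in>Ob C. \<forall>b\<in>Ob C. \<forall>f\<in>Hom C a b.
             Comp D (on_ob F a) (on_ob F b) (on_ob G b) (\<eta> b) (on_hom F a b f) =
             Comp D (on_ob F a) (on_ob G a) (on_ob G b) (on_hom G a b f) (\<eta> a)))"

definition equivalent_categories :: "('o, 'm) cat \<Rightarrow> ('p, 'n) cat \<Rightarrow> bool" where
  "equivalent_categories C D \<longleftrightarrow>
     (\<exists>F G. is_functor C D F \<and> is_functor D C G \<and>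
            naturally_isomorphic C C id_fctr (comp_fctr G F) \<and>
            naturally_isomorphic D D (comp_fctr F G) id_fctr)"


section \<open>Locally finite MV-algebras\<close>

record 'a mv = "'a partial_object" +
  oplus :: "'a \<Rightarrow> 'a \<Rightarrow> 'a"
  neg :: "'a \<Rightarrow> 'a"
  zer :: 'a

locale mv_algebra =
  fixes A :: "'a mv"
  assumes monoid_oplus: "monoid \<lparr>carrier = carrier A, mult = oplus A, one = zer A\<rparr>"
    and neg_closed: "x \<in> carrier A \<Longrightarrow> neg A x \<in> carrier A"
    and neg_neg: "x \<in> carrier A \<Longrightarrow> neg A (neg A x) = x"
    and neg_zer_oplus: "x \<in> carrier A \<Longrightarrow> oplus A (neg A (zer A)) x = neg A (zer A)"
    and lukasiewicz:
      "\<lbrakk>x \<in> carrier A; y \<in> carrier A\<rbrakk>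
        \<Longrightarrow> oplus A (neg A (oplus A (neg A x) y)) y = oplus A (neg A (oplus A (neg A y) x)) x"

definition mv_subalgebra :: "'a mv \<Rightarrow> 'a set \<Rightarrow> bool" where
  "mv_subalgebra A B \<longleftrightarrow> B \<subseteq> carrier A \<and> zer A \<in> B \<and>
     (\<forall>x\<in>B. neg A x \<in> B) \<and> (\<forall>x\<in>B. \<forall>y\<in>B. oplus A x y \<in> B)"

definition mv_generated :: "'a mv \<Rightarrow> 'a set \<Rightarrow> 'a set" where
  "mv_generated A X = \<Inter>{B. mv_subalgebra A B \<and> X \<subseteq> B}"

definition mv_locally_finite :: "'a mv \<Rightarrow> bool" where
  "mv_locally_finite A \<longleftrightarrow> (\<forall>X. X \<subseteq> carrier A \<and> finite X \<longrightarrow> finite (mv_generated A X))"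

text \<open>Homomorphisms are extensional on the carrier, so that equal maps are equal in HOL.\<close>

definition mv_hom :: "'a mv \<Rightarrow> 'b mv \<Rightarrow> ('a \<Rightarrow> 'b) set" where
  "mv_hom A B = {h \<in> carrier A \<rightarrow>\<^sub>E carrier B.
     h (zer A) = zer B \<and>
     (\<forall>x\<in>carrier A. h (neg A x) = neg B (h x)) \<and>
     (\<forall>x\<in>carrier A. \<forall>y\<in>carrier A. h (oplus A x y) = oplus B (h x) (h y))}"

definition lfmv_cat :: "('u mv, 'u \<Rightarrow> 'u) cat" where
  "lfmv_cat =
     \<lparr>Ob = {A. mv_algebra A \<and> mv_locally_finite A \<and> is_set (carrier A)},
      Hom = mv_hom,
      Ident = (\<lambda>A. restrict (\<lambda>x. x) (carrier A)),
      Comp = (\<lambda>A B C g f. compose (carrier A) g f)\<rparr>"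


section \<open>Varieties of finitary algebras\<close>

text \<open>
  The symbols of a signature are taken from an arbitrary type, so there may be a proper class
  of them.
\<close>

record 'f signature =
  symbols :: "'f set"
  arity :: "'f \<Rightarrow> nat"

record ('f, 'a) alg = "'a partial_object" +
  oper :: "'f \<Rightarrow> 'a list \<Rightarrow> 'a"

text \<open>The carrier of an algebra may be empty.\<close>

definition is_algebra :: "'f signature \<Rightarrow> ('f, 'a) alg \<Rightarrow> bool" where
  "is_algebra Sg A \<longleftrightarrow>
     (\<forall>f\<in>symbols Sg. \<forall>xs\<in>lists (carrier A). length xs = arity Sg f \<longrightarrow> oper A f xs \<in> carrier A)"

definition alg_hom :: "'f signature \<Rightarrow> ('f, 'a) alg \<Rightarrow> ('f, 'b) alg \<Rightarrow> ('a \<Rightarrow> 'b) set" where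
  "alg_hom Sg A B = {h \<in> carrier A \<rightarrow>\<^sub>E carrier B.
     \<forall>f\<in>symbols Sg. \<forall>xs\<in>lists (carrier A). length xs = arity Sg f \<longrightarrow>
       h (oper A f xs) = oper B f (map h xs)}"

datatype ('f, 'x) trm = Var 'x | App 'f "('f, 'x) trm list"

inductive_set wf_terms :: "'f signature \<Rightarrow> ('f, 'x) trm set" for Sg where
  wf_Var: "Var x \<in> wf_terms Sg"
| wf_App: "\<lbrakk>f \<in> symbols Sg; length ts = arity Sg f; \<And>t. t \<in> set ts \<Longrightarrow> t \<in> wf_terms Sg\<rbrakk>
    \<Longrightarrow> App f ts \<in> wf_terms Sg"

primrec eval_term :: "('f, 'a) alg \<Rightarrow> ('x \<Rightarrow> 'a) \<Rightarrow> ('f, 'x) trm \<Rightarrow> 'a" where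
  "eval_term A s (Var x) = s x"
| "eval_term A s (App f ts) = oper A f (map (eval_term A s) ts)"

definition satisfies :: "('f, 'a) alg \<Rightarrow> ('f, 'x) trm \<times> ('f, 'x) trm \<Rightarrow> bool" where
  "satisfies A e \<longleftrightarrow> (\<forall>s. (\<forall>x. s x \<in> carrier A) \<longrightarrow> eval_term A s (fst e) = eval_term A s (snd e))"

text \<open>
  Finitary terms contain finitely many variables, so variables from \<open>nat\<close> suffice for writing
  equations.
\<close>

definition equational_class :: "'f signature \<Rightarrow> ('f, 'u) alg set \<Rightarrow> bool" where
  "equational_class Sg V \<longleftrightarrow>
     (\<exists>E :: (('f, nat) trm \<times> ('f, nat) trm) set. E \<subseteq> wf_terms Sg \<times> wf_terms Sg \<and>
        V = {A. is_algebra Sg A \<and> is_set (carrier A) \<and> (\<forall>e\<in>E. satisfies A e)})"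

definition free_over ::
    "'f signature \<Rightarrow> ('f, 'u) alg set \<Rightarrow> 'x set \<Rightarrow> ('f, 'u) alg \<Rightarrow> ('x \<Rightarrow> 'u) \<Rightarrow> bool" where
  "free_over Sg V X F \<iota> \<longleftrightarrow> F \<in> V \<and> \<iota> \<in> X \<rightarrow> carrier F \<and>
     (\<forall>B\<in>V. \<forall>g \<in> X \<rightarrow> carrier B. \<exists>!h. h \<in> alg_hom Sg F B \<and> (\<forall>x\<in>X. h (\<iota> x) = g x))"

definition finitary_variety :: "'f signature \<Rightarrow> ('f, 'u) alg set \<Rightarrow> bool" where
  "finitary_variety Sg V \<longleftrightarrow>
     equational_class Sg V \<and>
     (\<forall>X :: 'u set. is_set X \<longrightarrow> (\<exists>F \<iota>. free_over Sg V X F \<iota>))"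

definition variety_cat :: "'f signature \<Rightarrow> ('f, 'u) alg set \<Rightarrow> (('f, 'u) alg, 'u \<Rightarrow> 'u) cat" where
  "variety_cat Sg V =
     \<lparr>Ob = V,
      Hom = alg_hom Sg,
      Ident = (\<lambda>A. restrict (\<lambda>x. x) (carrier A)),
      Comp = (\<lambda>A B C g f. compose (carrier A) g f)\<rparr>"


section \<open>Both are categories\<close>

lemma mv_algebra_closed:
  assumes "mv_algebra A"
  shows "zer A \<in> carrier A"
    and "x \<in> carrier A \<Longrightarrow> neg A x \<in> carrier A"
    and "\<lbrakk>x \<in> carrier A; y \<in> carrier A\<rbrakk> \<Longrightarrow> oplus A x y \<in> carrier A"
proof -
  interpret mv_algebra A by fact
  show "x \<in> carrier A \<Longrightarrow> neg A x \<in> carrier A" by (rule neg_closed)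
  show "zer A \<in> carrier A" using monoid.one_closed[OF monoid_oplus] by simp
  show "\<lbrakk>x \<in> carrier A; y \<in> carrier A\<rbrakk> \<Longrightarrow> oplus A x y \<in> carrier A"
    using monoid.m_closed[OF monoid_oplus, of x y] by simp
qed

lemma category_lfmv_cat: "category lfmv_cat"
proof
  fix a :: "'a mv" assume "a \<in> Ob lfmv_cat"
  then show "Ident lfmv_cat a \<in> Hom lfmv_cat a a"
    by (auto simp: lfmv_cat_def mv_hom_def mv_algebra_closed)
next
  fix a b c :: "'a mv" and f g
  assume "a \<in> Ob lfmv_cat" "b \<in> Ob lfmv_cat" "c \<in> Ob lfmv_cat"
    and "f \<in> Hom lfmv_cat a b" and "g \<in> Hom lfmv_cat b c"
  then have A: "mv_algebra a" and f: "f \<in> mv_hom a b" and g: "g \<in> mv_hom b c"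
    by (simp_all add: lfmv_cat_def)
  have f_closed: "f x \<in> carrier b" if "x \<in> carrier a" for x
    using f that unfolding mv_hom_def by blast
  have g_closed: "g x \<in> carrier c" if "x \<in> carrier b" for x
    using g that unfolding mv_hom_def by blast
  have "compose (carrier a) g f \<in> carrier a \<rightarrow>\<^sub>E carrier c"
    unfolding compose_def using f_closed g_closed by (intro restrict_PiE_iff[THEN iffD2]) blast
  moreover have "f (zer a) = zer b" "g (zer b) = zer c"
    "\<And>x. x \<in> carrier a \<Longrightarrow> f (neg a x) = neg b (f x)"
    "\<And>x. x \<in> carrier b \<Longrightarrow> g (neg b x) = neg c (g x)"
    "\<And>x y. \<lbrakk>x \<in> carrier a; y \<in> carrier a\<rbrakk> \<Longrightarrow> f (oplus a x y) = oplus b (f x) (f y)"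
    "\<And>x y. \<lbrakk>x \<in> carrier b; y \<in> carrier b\<rbrakk> \<Longrightarrow> g (oplus b x y) = oplus c (g x) (g y)"
    using f g unfolding mv_hom_def by blast+
  ultimately have "compose (carrier a) g f \<in> mv_hom a c"
    by (simp add: mv_hom_def compose_eq mv_algebra_closed[OF A] f_closed)
  then show "Comp lfmv_cat a b c g f \<in> Hom lfmv_cat a c"
    by (simp add: lfmv_cat_def)
next
  fix a b :: "'a mv" and f
  assume "f \<in> Hom lfmv_cat a b"
  then have f: "f \<in> carrier a \<rightarrow>\<^sub>E carrier b" by (simp add: lfmv_cat_def mv_hom_def)
  show "Comp lfmv_cat a a b f (Ident lfmv_cat a) = f"
    using f by (auto simp: lfmv_cat_def compose_eq PiE_def
        intro: extensionalityI[where A = "carrier a"])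
  show "Comp lfmv_cat a b b (Ident lfmv_cat b) f = f"
    using f by (simp add: lfmv_cat_def Id_compose PiE_def)
next
  fix a b c d :: "'a mv" and f g h
  assume "f \<in> Hom lfmv_cat a b"
  then have "f \<in> carrier a \<rightarrow>\<^sub>E carrier b" by (simp add: lfmv_cat_def mv_hom_def)
  then show "Comp lfmv_cat a b d (Comp lfmv_cat b c d h g) f =
      Comp lfmv_cat a c d h (Comp lfmv_cat a b c g f)"
    by (simp add: lfmv_cat_def PiE_def compose_assoc[of f "carrier a" "carrier b"])
qed

lemma category_variety_cat:
  assumes "equational_class Sg V"
  shows "category (variety_cat Sg V)"
proof
  have alg: "is_algebra Sg A" if "A \<in> V" for A
    using assms that by (auto simp: equational_class_def)
  {
    fix a assume "a \<in> Ob (variety_cat Sg V)"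
    then have "is_algebra Sg a" using alg by (simp add: variety_cat_def)
    moreover have "map (restrict (\<lambda>x. x) (carrier a)) xs = xs" if "xs \<in> lists (carrier a)" for xs
      using that by (induction xs) auto
    ultimately show "Ident (variety_cat Sg V) a \<in> Hom (variety_cat Sg V) a a"
      by (auto simp: variety_cat_def alg_hom_def is_algebra_def)
  next
    fix a b c f g
    assume "a \<in> Ob (variety_cat Sg V)" and "f \<in> Hom (variety_cat Sg V) a b"
      and "g \<in> Hom (variety_cat Sg V) b c"
    then have A: "is_algebra Sg a" and f: "f \<in> alg_hom Sg a b" and g: "g \<in> alg_hom Sg b c"
      using alg by (simp_all add: variety_cat_def)
    have f_closed: "f x \<in> carrier b" if "x \<in> carrier a" for x
      using f that unfolding alg_hom_def by blast
    have g_closed: "g x \<in> carrier c" if "x \<in> carrier b" for x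
      using g that unfolding alg_hom_def by blast
    have "compose (carrier a) g f (oper a s xs) = oper c s (map (compose (carrier a) g f) xs)"
      if s: "s \<in> symbols Sg" "xs \<in> lists (carrier a)" "length xs = arity Sg s" for s xs
    proof -
      have fxs: "map f xs \<in> lists (carrier b)" using s(2) f_closed by auto
      have "oper a s xs \<in> carrier a" using A s by (simp add: is_algebra_def)
      then have "compose (carrier a) g f (oper a s xs) = g (f (oper a s xs))"
        by (simp add: compose_eq)
      also have "f (oper a s xs) = oper b s (map f xs)"
        using f s unfolding alg_hom_def by blast
      also have "g \<dots> = oper c s (map g (map f xs))"
      proof -
        have "\<forall>ys\<in>lists (carrier b). length ys = arity Sg s \<longrightarrow> g (oper b s ys) = oper c s (map g ys)"
          using g s(1) unfolding alg_hom_def by blast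
        then show ?thesis using fxs s(3) length_map by metis
      qed
      also have "map g (map f xs) = map (compose (carrier a) g f) xs"
        using s(2) by (auto simp: compose_eq)
      finally show ?thesis .
    qed
    moreover have "compose (carrier a) g f \<in> carrier a \<rightarrow>\<^sub>E carrier c"
      unfolding compose_def using f_closed g_closed by (intro restrict_PiE_iff[THEN iffD2]) blast
    ultimately show "Comp (variety_cat Sg V) a b c g f \<in> Hom (variety_cat Sg V) a c"
      by (simp add: variety_cat_def alg_hom_def)
  next
    fix a b f
    assume "f \<in> Hom (variety_cat Sg V) a b"
    then have f: "f \<in> carrier a \<rightarrow>\<^sub>E carrier b" by (simp add: variety_cat_def alg_hom_def)
    show "Comp (variety_cat Sg V) a a b f (Ident (variety_cat Sg V) a) = f"
      using f by (auto simp: variety_cat_def compose_eq PiE_def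
        intro: extensionalityI[where A = "carrier a"])
    show "Comp (variety_cat Sg V) a b b (Ident (variety_cat Sg V) b) f = f"
      using f by (simp add: variety_cat_def Id_compose PiE_def)
  next
    fix a b c d f g h
    assume "f \<in> Hom (variety_cat Sg V) a b"
    then have "f \<in> carrier a \<rightarrow>\<^sub>E carrier b" by (simp add: variety_cat_def alg_hom_def)
    then show "Comp (variety_cat Sg V) a b d (Comp (variety_cat Sg V) b c d h g) f =
        Comp (variety_cat Sg V) a c d h (Comp (variety_cat Sg V) a b c g f)"
      by (simp add: variety_cat_def PiE_def compose_assoc[of f "carrier a" "carrier b"])
  }
qed

end

(*
  Let T be the free algebra on one generator of a finitary variety V, and P the MV-algebra that
  corresponds to it under an equivalence. As P is the directed union of its finitely generated
  (hence finite) subalgebras, finitarity makes P a retract of one of them, so P is finite.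
  Homomorphisms from T detect isomorphisms in V, so homomorphisms from P do in the category of
  locally finite MV-algebras. But if p is a prime larger than the cardinality of P, then every
  homomorphism from P to the chain with p + 1 elements has its image in the two-element subalgebra,
  whose inclusion is not an isomorphism.
*)

theory Submission
  imports "HOL-Computational_Algebra.Primes" Defs
begin

section \<open>Equivalences are fully faithful and essentially surjective\<close>

context category
begin

lemma iso_cancel_left:
  assumes "iso_in C b c h" "a \<in> Ob C" "b \<in> Ob C" "c \<in> Ob C" "f \<in> Hom C a b" "g \<in> Hom C a b"
    and eq: "Comp C a b c h f = Comp C a b c h g"
  shows "f = g"
proof -
  obtain k where h: "h \<in> Hom C b c" and k: "k \<in> Hom C c b" "Comp C b c b k h = Ident C b"
    using assms(1) unfolding iso_in_def by blast
  have "Comp C a c b k (Comp C a b c h f') = f'" if "f' \<in> Hom C a b" for f'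
    using Comp_assoc[of a b c b f' h k] Ident_Comp[of a b f'] assms(2-4) h k that by simp
  then show ?thesis using eq assms(5,6) by metis
qed

lemma iso_cancel_right:
  assumes "iso_in C a b h" "a \<in> Ob C" "b \<in> Ob C" "c \<in> Ob C" "f \<in> Hom C b c" "g \<in> Hom C b c"
    and eq: "Comp C a b c f h = Comp C a b c g h"
  shows "f = g"
proof -
  obtain k where h: "h \<in> Hom C a b" and k: "k \<in> Hom C b a" "Comp C b a b h k = Ident C b"
    using assms(1) unfolding iso_in_def by blast
  have "Comp C b a c (Comp C a b c f' h) k = f'" if "f' \<in> Hom C b c" for f'
    using Comp_assoc[of b a b c k h f'] Comp_Ident[of b c f'] assms(2-4) h k that by simp
  then show ?thesis using eq assms(5,6) by metis
qed

end

lemma functor_ob: "is_functor C D F \<Longrightarrow> a \<in> Ob C \<Longrightarrow> on_ob F a \<in> Ob D"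
  unfolding is_functor_def by blast

lemma functor_hom:
  "\<lbrakk>is_functor C D F; a \<in> Ob C; b \<in> Ob C; f \<in> Hom C a b\<rbrakk>
    \<Longrightarrow> on_hom F a b f \<in> Hom D (on_ob F a) (on_ob F b)"
  unfolding is_functor_def by blast

lemma functor_ident:
  "is_functor C D F \<Longrightarrow> a \<in> Ob C \<Longrightarrow> on_hom F a a (Ident C a) = Ident D (on_ob F a)"
  unfolding is_functor_def by blast

lemma functor_comp:
  "\<lbrakk>is_functor C D F; a \<in> Ob C; b \<in> Ob C; c \<in> Ob C; f \<in> Hom C a b; g \<in> Hom C b c\<rbrakk>
    \<Longrightarrow> on_hom F a c (Comp C a b c g f) =
      Comp D (on_ob F a) (on_ob F b) (on_ob F c) (on_hom F b c g) (on_hom F a b f)"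
  unfolding is_functor_def by blast

text \<open>Faithfulness of both functors is naturality plus cancellation of the components
  \<open>\<eta> b\<close> and \<open>\<epsilon> a\<close>. Fullness of \<open>G\<close> then uses
  faithfulness of \<open>F\<close>, and essential surjectivity is witnessed by \<open>\<eta>\<close>
  itself.\<close>

lemma equivalence_imp_fully_faithful:
  assumes C: "category C" and D: "category D" and "equivalent_categories C D"
  obtains G where "is_functor D C G"
    and "\<And>a b. \<lbrakk>a \<in> Ob D; b \<in> Ob D\<rbrakk> \<Longrightarrow>
      bij_betw (on_hom G a b) (Hom D a b) (Hom C (on_ob G a) (on_ob G b))"
    and "\<And>c. c \<in> Ob C \<Longrightarrow> \<exists>d\<in>Ob D. \<exists>h. iso_in C c (on_ob G d) h"
proof -
  interpret C: category C by fact
  interpret D: category D by fact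
  obtain F G where F: "is_functor C D F" and G: "is_functor D C G"
    and \<eta>: "naturally_isomorphic C C id_fctr (comp_fctr G F)"
    and \<epsilon>: "naturally_isomorphic D D (comp_fctr F G) id_fctr"
    using assms(3) unfolding equivalent_categories_def by blast
  obtain \<eta> where
    eta: "\<And>a. a \<in> Ob C \<Longrightarrow> iso_in C a (on_ob G (on_ob F a)) (\<eta> a)" and
    eta_nat: "\<And>a b f. \<lbrakk>a \<in> Ob C; b \<in> Ob C; f \<in> Hom C a b\<rbrakk> \<Longrightarrow>
      Comp C a b (on_ob G (on_ob F b)) (\<eta> b) f =
      Comp C a (on_ob G (on_ob F a)) (on_ob G (on_ob F b))
        (on_hom G (on_ob F a) (on_ob F b) (on_hom F a b f)) (\<eta> a)"
    using \<eta> unfolding naturally_isomorphic_def id_fctr_def comp_fctr_def fctr.simps by blast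
  obtain \<epsilon> where
    eps: "\<And>a. a \<in> Ob D \<Longrightarrow> iso_in D (on_ob F (on_ob G a)) a (\<epsilon> a)" and
    eps_nat: "\<And>a b f. \<lbrakk>a \<in> Ob D; b \<in> Ob D; f \<in> Hom D a b\<rbrakk> \<Longrightarrow>
      Comp D (on_ob F (on_ob G a)) (on_ob F (on_ob G b)) b (\<epsilon> b)
        (on_hom F (on_ob G a) (on_ob G b) (on_hom G a b f)) =
      Comp D (on_ob F (on_ob G a)) a b f (\<epsilon> a)"
    using \<epsilon> unfolding naturally_isomorphic_def id_fctr_def comp_fctr_def fctr.simps by blast
  note Fo = functor_ob[OF F] and Go = functor_ob[OF G]
    and Fh = functor_hom[OF F] and Gh = functor_hom[OF G]
  have F_inj: "f = g" if "a \<in> Ob C" "b \<in> Ob C" "f \<in> Hom C a b" "g \<in> Hom C a b"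
    "on_hom F a b f = on_hom F a b g" for a b f g
    using C.iso_cancel_left[OF eta[of b], of a f g] eta_nat[of a b f] eta_nat[of a b g] that
      Fo Go by simp
  have G_inj: "f = g" if "a \<in> Ob D" "b \<in> Ob D" "f \<in> Hom D a b" "g \<in> Hom D a b"
    "on_hom G a b f = on_hom G a b g" for a b f g
    using D.iso_cancel_right[OF eps[of a], of b f g] eps_nat[of a b f] eps_nat[of a b g] that
      Fo Go by simp
  have G_surj: "\<exists>f\<in>Hom D a b. on_hom G a b f = k"
    if ab: "a \<in> Ob D" "b \<in> Ob D" and k: "k \<in> Hom C (on_ob G a) (on_ob G b)" for a b k
  proof -
    let ?a = "on_ob F (on_ob G a)" and ?b = "on_ob F (on_ob G b)"
    let ?k = "on_hom F (on_ob G a) (on_ob G b) k"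
    have obs: "?a \<in> Ob D" "?b \<in> Ob D" using Fo Go ab by auto
    obtain e where ea: "\<epsilon> a \<in> Hom D ?a a" and e: "e \<in> Hom D a ?a" "Comp D ?a a ?a e (\<epsilon> a) = Ident D ?a"
      using eps[OF ab(1)] unfolding iso_in_def by blast
    have eb: "\<epsilon> b \<in> Hom D ?b b" using eps[OF ab(2)] unfolding iso_in_def by blast
    have k': "?k \<in> Hom D ?a ?b" using Fh Go ab k by simp
    have ek: "Comp D ?a ?b b (\<epsilon> b) ?k \<in> Hom D ?a b"
      using D.Comp_in_Hom obs ab eb k' by blast
    \<comment> \<open>The preimage of \<open>k\<close> is \<open>F k\<close> conjugated by
      \<open>\<epsilon>\<close>. Naturality of \<open>\<epsilon>\<close> at \<open>f\<close> forces
      \<open>F (G f) = F k\<close>, and \<open>F\<close> is faithful.\<close>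
    define f where "f = Comp D a ?a b (Comp D ?a ?b b (\<epsilon> b) ?k) e"
    have f: "f \<in> Hom D a b" unfolding f_def using D.Comp_in_Hom obs ab ek e by blast
    have "Comp D ?a a b f (\<epsilon> a) = Comp D ?a ?b b (\<epsilon> b) ?k"
      unfolding f_def using D.Comp_assoc[OF obs(1) ab(1) obs(1) ab(2) ea e(1) ek]
        D.Comp_Ident[OF obs(1) ab(2) ek] e(2) by simp
    then have "Comp D ?a ?b b (\<epsilon> b) (on_hom F (on_ob G a) (on_ob G b) (on_hom G a b f)) =
        Comp D ?a ?b b (\<epsilon> b) ?k"
      using eps_nat[OF ab f] by simp
    then have "on_hom F (on_ob G a) (on_ob G b) (on_hom G a b f) = ?k"
      using D.iso_cancel_left[OF eps[OF ab(2)] obs ab(2)] Fh[OF Go[OF ab(1)] Go[OF ab(2)]]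
        Gh[OF ab f] k' by blast
    then have "on_hom G a b f = k"
      using F_inj[OF Go[OF ab(1)] Go[OF ab(2)]] Gh[OF ab f] k by blast
    then show ?thesis using f by blast
  qed
  show ?thesis
  proof (rule that[OF G])
    show "bij_betw (on_hom G a b) (Hom D a b) (Hom C (on_ob G a) (on_ob G b))"
      if "a \<in> Ob D" "b \<in> Ob D" for a b
    proof (rule bij_betw_imageI)
      show "inj_on (on_hom G a b) (Hom D a b)" using G_inj that by (blast intro: inj_onI)
      show "on_hom G a b ` Hom D a b = Hom C (on_ob G a) (on_ob G b)"
        using Gh[OF that] G_surj[OF that] by (auto simp: image_iff)
    qed
    show "\<exists>d\<in>Ob D. \<exists>h. iso_in C c (on_ob G d) h" if "c \<in> Ob C" for c
      using eta Fo that by blast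
  qed
qed


section \<open>Subalgebras and chains\<close>

abbreviation sub_mv :: "'a mv \<Rightarrow> 'a set \<Rightarrow> 'a mv" where
  "sub_mv A B \<equiv> A\<lparr>carrier := B\<rparr>"

lemma mv_algebra_sub_mv:
  assumes "mv_algebra A" "mv_subalgebra A B"
  shows "mv_algebra (sub_mv A B)"
proof -
  interpret mv_algebra A by fact
  have B: "B \<subseteq> carrier A" "zer A \<in> B" "\<And>x. x \<in> B \<Longrightarrow> neg A x \<in> B"
    "\<And>x y. \<lbrakk>x \<in> B; y \<in> B\<rbrakk> \<Longrightarrow> oplus A x y \<in> B"
    using assms(2) unfolding mv_subalgebra_def by auto
  have assoc: "oplus A (oplus A x y) z = oplus A x (oplus A y z)"
    if "x \<in> carrier A" "y \<in> carrier A" "z \<in> carrier A" for x y z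
    using monoid.m_assoc[OF monoid_oplus] that by simp
  have unit: "oplus A (zer A) x = x" "oplus A x (zer A) = x" if "x \<in> carrier A" for x
    using monoid.l_one[OF monoid_oplus] monoid.r_one[OF monoid_oplus] that by simp_all
  show ?thesis
  proof (rule mv_algebra.intro)
    show "monoid \<lparr>carrier = carrier (sub_mv A B), mult = oplus (sub_mv A B), one = zer (sub_mv A B)\<rparr>"
      using B by (intro monoidI) (auto simp: assoc unit subset_iff)
  qed (use B neg_neg neg_zer_oplus lukasiewicz in \<open>auto simp: subset_iff\<close>)
qed

section \<open>Homomorphisms into subalgebras\<close>

lemma mv_hom_in_carrier: "f \<in> mv_hom A B \<Longrightarrow> x \<in> carrier A \<Longrightarrow> f x \<in> carrier B"
  unfolding mv_hom_def by blast

text \<open>Passing to a subalgebra changes only the carrier and keeps the operations of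
  \<open>B\<close>. The same function therefore serves as a homomorphism into different codomains,
  which makes corestriction and inclusion free of coercions.\<close>

lemma mv_hom_sub_mv:
  "f \<in> mv_hom A (sub_mv B S) \<longleftrightarrow> f \<in> carrier A \<rightarrow>\<^sub>E S \<and> f (zer A) = zer B \<and>
     (\<forall>x\<in>carrier A. f (neg A x) = neg B (f x)) \<and>
     (\<forall>x\<in>carrier A. \<forall>y\<in>carrier A. f (oplus A x y) = oplus B (f x) (f y))"
  unfolding mv_hom_def by simp

lemma mv_hom_sub_mv_mono:
  "\<lbrakk>f \<in> mv_hom A (sub_mv B S); S \<subseteq> S'\<rbrakk> \<Longrightarrow> f \<in> mv_hom A (sub_mv B S')"
  unfolding mv_hom_sub_mv by (auto simp: PiE_iff)

lemma mv_hom_sub_mv_imp: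
  "\<lbrakk>f \<in> mv_hom A (sub_mv B S); S \<subseteq> carrier B\<rbrakk> \<Longrightarrow> f \<in> mv_hom A B"
  using mv_hom_sub_mv_mono[where S' = "carrier B" and B = B] by simp

lemma mv_hom_corestrict:
  "\<lbrakk>f \<in> mv_hom A B; f ` carrier A \<subseteq> S\<rbrakk> \<Longrightarrow> f \<in> mv_hom A (sub_mv B S)"
  unfolding mv_hom_sub_mv by (auto simp: mv_hom_def PiE_iff)

section \<open>Generated subalgebras and objects of the category\<close>

lemma mv_subalgebra_carrier: "mv_algebra A \<Longrightarrow> mv_subalgebra A (carrier A)"
  unfolding mv_subalgebra_def by (simp add: mv_algebra_closed)

text \<open>The carrier is one of the intersected subalgebras, so the intersection is over a
  nonempty family and stays inside the carrier.\<close>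

lemma mv_subalgebra_generated:
  assumes "mv_algebra A" "X \<subseteq> carrier A"
  shows "mv_subalgebra A (mv_generated A X)"
  using mv_subalgebra_carrier[OF assms(1)] assms(2)
  unfolding mv_subalgebra_def mv_generated_def by blast

lemma subset_mv_generated: "X \<subseteq> mv_generated A X"
  unfolding mv_generated_def by blast

lemma mv_generated_mono: "X \<subseteq> Y \<Longrightarrow> mv_generated A X \<subseteq> mv_generated A Y"
  unfolding mv_generated_def by blast

lemma finite_imp_is_set:
  assumes "infinite (UNIV :: 'u set)" "finite (X :: 'u set)"
  shows "is_set X"
  unfolding is_set_def using assms
  by (metis finite_lesspoll_infinite)

lemma is_set_subset: "is_set X \<Longrightarrow> Y \<subseteq> X \<Longrightarrow> is_set Y"
  unfolding is_set_def by (meson lesspoll_trans1 subset_imp_lepoll)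

lemma finite_mv_in_lfmv_cat:
  assumes "infinite (UNIV :: 'u set)" "mv_algebra (A :: 'u mv)" "finite (carrier A)"
  shows "A \<in> Ob lfmv_cat"
proof -
  have "mv_generated A X \<subseteq> carrier A" if "X \<subseteq> carrier A" for X
    using mv_subalgebra_generated[OF assms(2) that] unfolding mv_subalgebra_def by blast
  then show ?thesis
    using assms finite_imp_is_set
    by (auto simp: lfmv_cat_def mv_locally_finite_def intro: finite_subset)
qed

lemma lfmv_cat_obD:
  assumes "A \<in> Ob lfmv_cat"
  shows "mv_algebra A" "mv_locally_finite A"
  using assms by (simp_all add: lfmv_cat_def)

lemma mv_hom_compose:
  fixes A B C :: "'u mv"
  assumes "A \<in> Ob lfmv_cat" "B \<in> Ob lfmv_cat" "C \<in> Ob lfmv_cat" "f \<in> mv_hom A B" "g \<in> mv_hom B C"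
  shows "compose (carrier A) g f \<in> mv_hom A C"
  using category.Comp_in_Hom[OF category_lfmv_cat assms(1-3), of f g] assms(4,5)
  by (simp add: lfmv_cat_def)

section \<open>Finite chains and their subalgebras\<close>

text \<open>The chain with \<open>p + 1\<close> elements, with \<open>e k\<close> standing for the rational \<open>k / p\<close>.\<close>

definition mv_chain :: "(nat \<Rightarrow> 'u) \<Rightarrow> nat \<Rightarrow> 'u mv" where
  "mv_chain e p = \<lparr>carrier = e ` {..p},
     oplus = (\<lambda>x y. e (min p (inv_into UNIV e x + inv_into UNIV e y))),
     neg = (\<lambda>x. e (p - inv_into UNIV e x)),
     zer = e 0\<rparr>"

lemma mv_algebra_chain:
  assumes "inj e"
  shows "mv_algebra (mv_chain e p)"
proof (rule mv_algebra.intro)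
  \<comment> \<open>Both sides are the maximum of \<open>k\<close> and \<open>l\<close>: for
    \<open>k \<le> p\<close>, the term \<open>p - min p (p - k + l)\<close> is the truncated
    difference \<open>k - l\<close>.\<close>
  have luk: "min p (p - min p (p - k + l) + l) = min p (p - min p (p - l + k) + k)"
    if "k \<le> p" "l \<le> p" for k l
    using that by linarith
  show "oplus (mv_chain e p) (neg (mv_chain e p) (oplus (mv_chain e p) (neg (mv_chain e p) x) y)) y =
      oplus (mv_chain e p) (neg (mv_chain e p) (oplus (mv_chain e p) (neg (mv_chain e p) y) x)) x"
    if "x \<in> carrier (mv_chain e p)" "y \<in> carrier (mv_chain e p)" for x y
    using that assms luk by (auto simp: mv_chain_def)
  show "monoid \<lparr>carrier = carrier (mv_chain e p), mult = oplus (mv_chain e p), one = zer (mv_chain e p)\<rparr>"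
    using assms by (intro monoidI) (auto simp: mv_chain_def intro!: arg_cong[where f = e])
qed (use assms in \<open>auto simp: mv_chain_def\<close>)

text \<open>
  By the Euclidean algorithm, the least positive element of a subalgebra divides the top element.
\<close>

lemma prime_chain_subalgebra:
  assumes "inj e" "prime p" and S: "mv_subalgebra (mv_chain e p) S"
  shows "S \<subseteq> {e 0, e p} \<or> S = e ` {..p}"
proof (rule disjCI)
  assume "\<not> S = e ` {..p}"
  define K where "K = {k. k \<le> p \<and> e k \<in> S}"
  have S_eq: "S = e ` K" using S unfolding K_def mv_subalgebra_def mv_chain_def by auto
  have K_le: "k \<le> p" if "k \<in> K" for k using that unfolding K_def by simp
  have e: "inv_into UNIV e (e k) = k" for k using assms(1) by simp
  have K0: "0 \<in> K" using S unfolding K_def mv_subalgebra_def mv_chain_def by simp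
  have Kneg: "p - k \<in> K" if "k \<in> K" for k
    using S that e unfolding K_def mv_subalgebra_def mv_chain_def by force
  have Kadd: "min p (k + l) \<in> K" if "k \<in> K" "l \<in> K" for k l
    using S that e unfolding K_def mv_subalgebra_def mv_chain_def by force
  \<comment> \<open>Truncated subtraction is an MV-term: negate the sum of the negated first
    argument and the second.\<close>
  have Kdiff: "k - l \<in> K" if "k \<in> K" "l \<in> K" for k l
  proof -
    have "p - min p ((p - k) + l) = k - l" using K_le[OF that(1)] by auto
    then show ?thesis using Kneg[OF Kadd[OF Kneg[OF that(1)] that(2)]] by simp
  qed
  have Kp: "p \<in> K" using Kneg[OF K0] by simp
  have p0: "p > 0" using assms(2) by (simp add: prime_gt_0_nat)
  define m where "m = (LEAST k. 0 < k \<and> k \<in> K)"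
  have m: "0 < m" "m \<in> K" using LeastI[of "\<lambda>k. 0 < k \<and> k \<in> K" p] Kp p0 unfolding m_def by auto
  have m_le: "m \<le> k" if "0 < k" "k \<in> K" for k unfolding m_def using that by (simp add: Least_le)
  \<comment> \<open>Taking \<open>n = p div m\<close> yields the remainder \<open>p mod m\<close>,
    which lies in \<open>K\<close> below the least positive element and hence is 0.\<close>
  have "p - n * m \<in> K" for n
  proof (induction n)
    case (Suc n)
    have "p - Suc n * m = p - n * m - m" by simp
    then show ?case using Kdiff[OF Suc m(2)] by simp
  qed (use Kp in simp)
  then have "p mod m \<in> K" by (metis minus_div_mult_eq_mod)
  then have "p mod m = 0" using m_le m(1) mod_less_divisor by (metis not_gr0 not_le)
  then have "m dvd p" by auto
  then consider "m = 1" | "m = p" using assms(2) by (auto simp: prime_nat_iff)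
  then show "S \<subseteq> {e 0, e p}"
  proof cases
    \<comment> \<open>If 1 is in \<open>K\<close>, repeated addition fills the whole chain, which
      was excluded.\<close>
    case 1
    have "k \<le> p \<Longrightarrow> k \<in> K" for k
    proof (induction k)
      case (Suc k)
      then show ?case using Kadd[of k 1] m(2) 1 by (cases "p = Suc k") (auto simp: Kp)
    qed (use K0 in simp)
    then have "K = {..p}" using K_le by auto
    then show ?thesis using S_eq \<open>\<not> S = e ` {..p}\<close> by simp
  next
    case 2
    then have "k = 0 \<or> k = p" if "k \<in> K" for k using m_le that K_le by (metis le_antisym not_gr0)
    then show ?thesis using S_eq by auto
  qed
qed

lemma mv_hom_image_subalgebra:
  assumes "mv_algebra A" "f \<in> mv_hom A B"
  shows "mv_subalgebra B (f ` carrier A)"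
proof -
  have "f (zer A) = zer B" "\<And>x. x \<in> carrier A \<Longrightarrow> f (neg A x) = neg B (f x)"
    "\<And>x y. \<lbrakk>x \<in> carrier A; y \<in> carrier A\<rbrakk> \<Longrightarrow> f (oplus A x y) = oplus B (f x) (f y)"
    "\<And>x. x \<in> carrier A \<Longrightarrow> f x \<in> carrier B"
    using assms(2) unfolding mv_hom_def by blast+
  then show ?thesis
    unfolding mv_subalgebra_def using mv_algebra_closed[OF assms(1)]
    by (auto simp: image_iff) metis+
qed

text \<open>The image is a subalgebra, and it cannot be the whole chain, which has
  \<open>p + 1\<close> elements and so more than the domain.\<close>

lemma mv_hom_to_prime_chain:
  assumes "mv_algebra A" "finite (carrier A)" "inj e" "prime p" "card (carrier A) \<le> p"
    and f: "f \<in> mv_hom A (mv_chain e p)"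
  shows "f ` carrier A \<subseteq> {e 0, e p}"
proof (rule ccontr)
  assume "\<not> f ` carrier A \<subseteq> {e 0, e p}"
  then have "f ` carrier A = e ` {..p}"
    using prime_chain_subalgebra[OF assms(3,4) mv_hom_image_subalgebra[OF assms(1) f]] by blast
  then have "Suc p \<le> card (carrier A)"
    using card_image_le[OF assms(2), of f] card_image[of e "{..p}"] assms(3)
    by (simp add: inj_on_subset[OF assms(3)])
  then show False using assms(5) by simp
qed


section \<open>Varieties\<close>

lemma alg_hom_in_carrier: "h \<in> alg_hom Sg A B \<Longrightarrow> x \<in> carrier A \<Longrightarrow> h x \<in> carrier B"
  unfolding alg_hom_def by blast

lemma alg_hom_oper:
  "\<lbrakk>h \<in> alg_hom Sg A B; f \<in> symbols Sg; xs \<in> lists (carrier A); length xs = arity Sg f\<rbrakk>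
    \<Longrightarrow> h (oper A f xs) = oper B f (map h xs)"
  unfolding alg_hom_def by blast

lemma equational_class_imp_algebra: "equational_class Sg V \<Longrightarrow> A \<in> V \<Longrightarrow> is_algebra Sg A"
  unfolding equational_class_def by blast

text \<open>Term evaluation never consults the carrier, so shrinking the carrier only restricts the
  assignments over which an equation is quantified.\<close>

lemma equational_class_subalgebra:
  assumes "equational_class Sg V" "A \<in> V" "B \<subseteq> carrier A" "is_algebra Sg (A\<lparr>carrier := B\<rparr>)"
  shows "A\<lparr>carrier := B\<rparr> \<in> V"
proof -
  have "eval_term (A\<lparr>carrier := B\<rparr>) s t = eval_term A s t" for s :: "nat \<Rightarrow> 'b" and t
    by (induction t) (auto cong: map_cong)
  then have "satisfies (A\<lparr>carrier := B\<rparr>) e" if "satisfies A e" for e :: "('a, nat) trm \<times> ('a, nat) trm"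
    using that assms(3) unfolding satisfies_def by (simp add: subset_iff)
  then show ?thesis
    using assms is_set_subset[OF _ assms(3)] unfolding equational_class_def by auto
qed

text \<open>Bijective homomorphisms are the isomorphisms of a variety. This turns a statement about
  elements, which free algebras can see, into a categorical one.\<close>

lemma alg_hom_inverse:
  assumes "is_algebra Sg A" "h \<in> alg_hom Sg A B" "bij_betw h (carrier A) (carrier B)"
  shows "restrict (inv_into (carrier A) h) (carrier B) \<in> alg_hom Sg B A"
proof -
  let ?g = "inv_into (carrier A) h"
  have g: "?g y \<in> carrier A" "h (?g y) = y" if "y \<in> carrier B" for y
    using assms(3) that unfolding bij_betw_def by (auto simp: inv_into_into f_inv_into_f)
  have gh: "?g (h x) = x" if "x \<in> carrier A" for x
    using assms(3) that unfolding bij_betw_def by simp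
  have "restrict ?g (carrier B) (oper B f ys) = oper A f (map (restrict ?g (carrier B)) ys)"
    if f: "f \<in> symbols Sg" "ys \<in> lists (carrier B)" "length ys = arity Sg f" for f ys
  proof -
    let ?xs = "map ?g ys"
    have xs: "?xs \<in> lists (carrier A)" "length ?xs = arity Sg f" using f g(1) by auto
    have A: "oper A f ?xs \<in> carrier A" using assms(1) f(1) xs unfolding is_algebra_def by blast
    have "map h ?xs = ys" using f(2) g(2) by (intro nth_equalityI) auto
    then have "h (oper A f ?xs) = oper B f ys" using alg_hom_oper[OF assms(2) f(1) xs] by simp
    moreover have "oper B f ys \<in> carrier B" using alg_hom_in_carrier[OF assms(2) A] calculation by simp
    moreover have "map (restrict ?g (carrier B)) ys = ?xs" using f(2) by (intro map_cong) auto
    ultimately show ?thesis using gh[OF A] by (metis restrict_apply')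
  qed
  then show ?thesis using g(1) unfolding alg_hom_def by auto
qed

lemma alg_hom_compose:
  assumes "equational_class Sg V" "A \<in> V" "B \<in> V" "C \<in> V" "f \<in> alg_hom Sg A B" "g \<in> alg_hom Sg B C"
  shows "compose (carrier A) g f \<in> alg_hom Sg A C"
  using category.Comp_in_Hom[OF category_variety_cat[OF assms(1)], of A B C f g] assms(2-6)
  by (simp add: variety_cat_def)

lemma alg_hom_ident:
  assumes "equational_class Sg V" "A \<in> V"
  shows "restrict (\<lambda>x. x) (carrier A) \<in> alg_hom Sg A A"
  using category.Ident_in_Hom[OF category_variety_cat[OF assms(1)], of A] assms(2)
  by (simp add: variety_cat_def)

lemma alg_hom_subalgebra_iff:
  "h \<in> alg_hom Sg A (B\<lparr>carrier := S\<rparr>) \<longleftrightarrow> h \<in> carrier A \<rightarrow>\<^sub>E S \<and>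
     (\<forall>f\<in>symbols Sg. \<forall>xs\<in>lists (carrier A). length xs = arity Sg f \<longrightarrow>
       h (oper A f xs) = oper B f (map h xs))"
  unfolding alg_hom_def by simp

lemma alg_hom_subalgebra_inclusion:
  assumes "is_algebra Sg (A\<lparr>carrier := S\<rparr>)" "S \<subseteq> carrier A"
  shows "restrict (\<lambda>x. x) S \<in> alg_hom Sg (A\<lparr>carrier := S\<rparr>) A"
proof -
  have "restrict (\<lambda>x. x) S (oper A f xs) = oper A f (map (restrict (\<lambda>x. x) S) xs)"
    if "f \<in> symbols Sg" "xs \<in> lists S" "length xs = arity Sg f" for f xs
  proof -
    have "map (restrict (\<lambda>x. x) S) xs = xs" using that(2) by (intro map_idI) auto
    moreover have "oper A f xs \<in> S" using assms(1) that unfolding is_algebra_def by simp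
    ultimately show ?thesis by (simp only: restrict_apply')
  qed
  moreover have "restrict (\<lambda>x. x) S \<in> S \<rightarrow>\<^sub>E carrier A" using assms(2) by auto
  ultimately show ?thesis unfolding alg_hom_def by simp
qed

section \<open>The free algebra on one generator: its homomorphisms to \<open>B\<close> are the
  elements of \<open>B\<close>\<close>

lemma free_over_in_carrier:
  assumes "free_over Sg V {u} T \<iota>"
  shows "T \<in> V" "\<iota> u \<in> carrier T"
  using conjunct1[OF assms[unfolded free_over_def]]
    conjunct1[OF conjunct2[OF assms[unfolded free_over_def]]] by simp_all

lemma free_over_ex1:
  assumes "free_over Sg V {u} T \<iota>" "B \<in> V" "y \<in> carrier B"
  shows "\<exists>!h. h \<in> alg_hom Sg T B \<and> h (\<iota> u) = y"
proof -
  have "\<forall>B\<in>V. \<forall>g\<in>{u} \<rightarrow> carrier B. \<exists>!h. h \<in> alg_hom Sg T B \<and> (\<forall>x\<in>{u}. h (\<iota> x) = g x)"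
    using assms(1) unfolding free_over_def by (elim conjE)
  then have "\<exists>!h. h \<in> alg_hom Sg T B \<and> (\<forall>x\<in>{u}. h (\<iota> x) = (\<lambda>_. y) x)"
    using assms(2,3) by (elim ballE[where x = B] ballE[where x = "\<lambda>_. y"]) auto
  then show ?thesis by simp
qed

lemma free_over_extend:
  assumes "free_over Sg V {u} T \<iota>" "B \<in> V" "y \<in> carrier B"
  obtains h where "h \<in> alg_hom Sg T B" "h (\<iota> u) = y"
  using ex1_implies_ex[OF free_over_ex1[OF assms]] that by (elim exE conjE)

lemma free_over_unique:
  assumes "free_over Sg V {u} T \<iota>" "B \<in> V" "f \<in> alg_hom Sg T B" "g \<in> alg_hom Sg T B"
    and "f (\<iota> u) = g (\<iota> u)"
  shows "f = g"
proof -
  have "g (\<iota> u) \<in> carrier B"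
    by (rule alg_hom_in_carrier[OF assms(4) free_over_in_carrier(2)[OF assms(1)]])
  from free_over_ex1[OF assms(1,2) this] show ?thesis
    by (rule ex1E) (use assms(3-5) in metis)
qed


section \<open>A variety equivalent to the locally finite MV-algebras\<close>

text \<open>Of an equivalence, the argument keeps one functor, from the variety to the MV-algebras;
  each MV-algebra is represented by an algebra of \<open>V\<close> chosen when it is needed.\<close>

locale lfmv_equivalence =
  fixes Sg :: "'f signature" and V :: "('f, 'u) alg set"
    and G :: "(('f, 'u) alg, 'u \<Rightarrow> 'u, 'u mv, 'u \<Rightarrow> 'u) fctr"
  assumes infinite_universe: "infinite (UNIV :: 'u set)"
    and V: "equational_class Sg V"
    and G: "is_functor (variety_cat Sg V) lfmv_cat G"
    and G_bij: "\<And>A B. \<lbrakk>A \<in> V; B \<in> V\<rbrakk> \<Longrightarrow>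
      bij_betw (on_hom G A B) (alg_hom Sg A B) (mv_hom (on_ob G A) (on_ob G B))"
    and G_ess_surj: "\<And>L. L \<in> Ob lfmv_cat \<Longrightarrow> \<exists>A\<in>V. \<exists>h. iso_in lfmv_cat L (on_ob G A) h"
begin

lemma G_ob: "A \<in> V \<Longrightarrow> on_ob G A \<in> Ob lfmv_cat"
  using functor_ob[OF G] by (simp add: variety_cat_def)

lemma G_hom: "\<lbrakk>A \<in> V; B \<in> V; f \<in> alg_hom Sg A B\<rbrakk> \<Longrightarrow> on_hom G A B f \<in> mv_hom (on_ob G A) (on_ob G B)"
  by (rule bij_betw_apply[OF G_bij])

lemma G_ident:
  "\<lbrakk>A \<in> V; x \<in> carrier (on_ob G A)\<rbrakk> \<Longrightarrow> on_hom G A A (restrict (\<lambda>x. x) (carrier A)) x = x"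
  using functor_ident[OF G, of A] by (simp add: variety_cat_def lfmv_cat_def)

lemma G_compose:
  "\<lbrakk>A \<in> V; B \<in> V; C \<in> V; f \<in> alg_hom Sg A B; g \<in> alg_hom Sg B C; x \<in> carrier (on_ob G A)\<rbrakk>
    \<Longrightarrow> on_hom G A C (compose (carrier A) g f) x = on_hom G B C g (on_hom G A B f x)"
  using functor_comp[OF G, of A B C f g] by (simp add: variety_cat_def lfmv_cat_def compose_eq)

lemma G_full:
  assumes "A \<in> V" "B \<in> V" "k \<in> mv_hom (on_ob G A) (on_ob G B)"
  obtains f where "f \<in> alg_hom Sg A B" "on_hom G A B f = k"
  using that assms(3) unfolding bij_betw_imp_surj_on[OF G_bij[OF assms(1,2)], symmetric]
  by (elim imageE) simp

lemma G_faithful: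
  assumes "A \<in> V" "B \<in> V" "f \<in> alg_hom Sg A B" "g \<in> alg_hom Sg A B"
    and "\<And>x. x \<in> carrier (on_ob G A) \<Longrightarrow> on_hom G A B f x = on_hom G A B g x"
  shows "f = g"
proof -
  have "on_hom G A B f \<in> extensional (carrier (on_ob G A))"
    "on_hom G A B g \<in> extensional (carrier (on_ob G A))"
    using G_hom[OF assms(1,2)] assms(3,4) unfolding mv_hom_def PiE_def by simp_all
  then have "on_hom G A B f = on_hom G A B g" using assms(5) by (rule extensionalityI)
  then show ?thesis
    using inj_onD[OF bij_betw_imp_inj_on[OF G_bij[OF assms(1,2)]]] assms(3,4) by simp
qed

text \<open>Conjugating with such pairs \<open>\<eta>\<close>, \<open>\<theta>\<close> turns a map
  between MV-algebras into one between values of \<open>G\<close>, which fullness then lifts to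
  \<open>V\<close>.\<close>

lemma G_represent:
  assumes "(L :: 'u mv) \<in> Ob lfmv_cat"
  shows "\<exists>A \<eta> \<theta>. A \<in> V \<and> \<eta> \<in> mv_hom L (on_ob G A) \<and> \<theta> \<in> mv_hom (on_ob G A) L \<and>
    (\<forall>x\<in>carrier L. \<theta> (\<eta> x) = x) \<and> (\<forall>y\<in>carrier (on_ob G A). \<eta> (\<theta> y) = y)"
proof -
  obtain A \<eta> where A: "A \<in> V" and iso: "iso_in lfmv_cat L (on_ob G A) \<eta>"
    using G_ess_surj[OF assms] by (elim bexE exE)
  from iso obtain \<theta> where \<eta>: "\<eta> \<in> mv_hom L (on_ob G A)" and \<theta>: "\<theta> \<in> mv_hom (on_ob G A) L"
    and inv: "compose (carrier L) \<theta> \<eta> = restrict (\<lambda>x. x) (carrier L)"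
      "compose (carrier (on_ob G A)) \<eta> \<theta> = restrict (\<lambda>x. x) (carrier (on_ob G A))"
    unfolding iso_in_def lfmv_cat_def cat.simps by (elim conjE bexE)
  have "\<theta> (\<eta> x) = x" if "x \<in> carrier L" for x
    using fun_cong[OF inv(1), of x] that by (simp add: compose_eq)
  moreover have "\<eta> (\<theta> y) = y" if "y \<in> carrier (on_ob G A)" for y
    using fun_cong[OF inv(2), of y] that by (simp add: compose_eq)
  ultimately show ?thesis using A \<eta> \<theta> by (intro exI[of _ A] exI[of _ \<eta>] exI[of _ \<theta>]) simp
qed

text \<open>
  This is where finitarity enters: an algebra of \<open>V\<close> is the union of the images of any directed
  family of which it is the colimit, so the free algebra on one generator is a retract of the
  object representing some finitely generated subalgebra.
\<close>

lemma finite_free: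
  assumes free: "free_over Sg V {u} T \<iota>"
  shows "finite (carrier (on_ob G T))"
proof -
  define P where "P = on_ob G T"
  \<comment> \<open>The finite subsets of \<open>P\<close> are directed by union and index its
    finitely generated subalgebras.\<close>
  define Fin where "Fin = {X. finite X \<and> X \<subseteq> carrier P}"
  define gen where "gen X = mv_generated P X" for X
  note T = free_over_in_carrier[OF free]
  have P: "mv_algebra P" "mv_locally_finite P"
    using lfmv_cat_obD[OF G_ob[OF T(1)]] unfolding P_def .
  have sub: "mv_subalgebra P (gen X)" if "X \<in> Fin" for X
    unfolding gen_def by (rule mv_subalgebra_generated[OF P(1)]) (use that in \<open>simp add: Fin_def\<close>)
  have gen_carrier: "gen X \<subseteq> carrier P" if "X \<in> Fin" for X
    using sub[OF that] unfolding mv_subalgebra_def by simp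
  have gen_mono: "gen X \<subseteq> gen Y" if "X \<subseteq> Y" for X Y
    unfolding gen_def by (rule mv_generated_mono[OF that])
  have gen_ext: "X \<subseteq> gen X" for X
    unfolding gen_def by (rule subset_mv_generated)
  have Fin_union: "X \<union> Y \<in> Fin" if "X \<in> Fin" "Y \<in> Fin" for X Y
    using that unfolding Fin_def by simp
  have gen_finite: "finite (gen X)" if "X \<in> Fin" for X
    using P(2) that unfolding mv_locally_finite_def Fin_def gen_def by simp
  have ob: "sub_mv P (gen X) \<in> Ob lfmv_cat" if "X \<in> Fin" for X
    using finite_mv_in_lfmv_cat[OF infinite_universe mv_algebra_sub_mv[OF P(1) sub[OF that]]]
      gen_finite[OF that] by simp
  \<comment> \<open>One predicate bundles the data for \<open>X\<close>, so that the three families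
    \<open>A\<close>, \<open>\<eta>\<close> and \<open>\<theta>\<close> can be chosen
    simultaneously.\<close>
  define R where "R X A \<eta> \<theta> \<longleftrightarrow> A \<in> V \<and> \<eta> \<in> mv_hom (sub_mv P (gen X)) (on_ob G A) \<and>
      \<theta> \<in> mv_hom (on_ob G A) (sub_mv P (gen X)) \<and> (\<forall>x\<in>gen X. \<theta> (\<eta> x) = x)" for X A \<eta> \<theta>
  have "\<exists>A \<eta> \<theta>. R X A \<eta> \<theta>" if "X \<in> Fin" for X
    using G_represent[OF ob[OF that]] unfolding R_def by (elim exE conjE) auto
  then obtain A \<eta> \<theta> where R: "\<And>X. X \<in> Fin \<Longrightarrow> R X (A X) (\<eta> X) (\<theta> X)"
    by metis
  have A: "A X \<in> V" and eta: "\<eta> X \<in> mv_hom (sub_mv P (gen X)) (on_ob G (A X))"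
    and theta: "\<theta> X \<in> mv_hom (on_ob G (A X)) (sub_mv P (gen X))" if "X \<in> Fin" for X
    using R[OF that] unfolding R_def by simp_all
  have theta_eta: "\<theta> X (\<eta> X x) = x" if "X \<in> Fin" "x \<in> gen X" for X x
    using R[OF that(1)] that(2) unfolding R_def by simp
  have GA: "on_ob G (A X) \<in> Ob lfmv_cat" if "X \<in> Fin" for X using G_ob A that by blast
  have eta_in: "\<eta> X x \<in> carrier (on_ob G (A X))" if "X \<in> Fin" "x \<in> gen X" for X x
    using mv_hom_in_carrier[OF eta] that by simp
  have theta_in: "\<theta> X y \<in> gen X" if "X \<in> Fin" "y \<in> carrier (on_ob G (A X))" for X y
    using mv_hom_in_carrier[OF theta] that by simp
  \<comment> \<open>The morphism \<open>v X\<close> of \<open>V\<close> corresponds to the inclusion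
    of \<open>gen X\<close> into \<open>P\<close>.\<close>
  have "\<exists>v. v \<in> alg_hom Sg (A X) T \<and> on_hom G (A X) T v = \<theta> X" if "X \<in> Fin" for X
    using G_full[OF A[OF that] T(1)] mv_hom_sub_mv_imp[OF theta[OF that] gen_carrier[OF that]]
    unfolding P_def by blast
  then obtain v where v: "\<And>X. X \<in> Fin \<Longrightarrow> v X \<in> alg_hom Sg (A X) T"
    and Gv: "\<And>X. X \<in> Fin \<Longrightarrow> on_hom G (A X) T (v X) = \<theta> X"
    by metis
  \<comment> \<open>The morphism \<open>m\<close> corresponds to the inclusion of
    \<open>gen X\<close> into \<open>gen Y\<close>; by faithfulness the maps \<open>v X\<close> are
    compatible with it.\<close>
  have transition: "\<exists>m\<in>alg_hom Sg (A X) (A Y). v X = compose (carrier (A X)) (v Y) m \<and>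
      (\<forall>x\<in>carrier (on_ob G (A X)). on_hom G (A X) (A Y) m x = \<eta> Y (\<theta> X x))"
    if XY: "X \<in> Fin" "Y \<in> Fin" "X \<subseteq> Y" for X Y
  proof -
    have "compose (carrier (on_ob G (A X))) (\<eta> Y) (\<theta> X) \<in> mv_hom (on_ob G (A X)) (on_ob G (A Y))"
      using mv_hom_compose[OF GA[OF XY(1)] ob[OF XY(2)] GA[OF XY(2)] _ eta[OF XY(2)]]
        mv_hom_sub_mv_mono[OF theta[OF XY(1)] gen_mono[OF XY(3)]] by blast
    then obtain m where m: "m \<in> alg_hom Sg (A X) (A Y)"
      "on_hom G (A X) (A Y) m = compose (carrier (on_ob G (A X))) (\<eta> Y) (\<theta> X)"
      using G_full[OF A A] XY by metis
    have "v X = compose (carrier (A X)) (v Y) m"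
    proof (rule G_faithful[OF A[OF XY(1)] T(1) v[OF XY(1)]])
      show "compose (carrier (A X)) (v Y) m \<in> alg_hom Sg (A X) T"
        using alg_hom_compose[OF V A[OF XY(1)] A[OF XY(2)] T(1) m(1) v[OF XY(2)]] .
      fix x assume x: "x \<in> carrier (on_ob G (A X))"
      have "\<theta> X x \<in> gen Y" using theta_in[OF XY(1) x] gen_mono[OF XY(3)] by blast
      then show "on_hom G (A X) T (v X) x = on_hom G (A X) T (compose (carrier (A X)) (v Y) m) x"
        using G_compose[OF A[OF XY(1)] A[OF XY(2)] T(1) m(1) v[OF XY(2)] x] x XY
        by (simp add: m(2) Gv compose_eq theta_eta)
    qed
    then show ?thesis using m by (auto simp: compose_eq)
  qed
  have img_mono: "v X ` carrier (A X) \<subseteq> v Y ` carrier (A Y)"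
    if XY: "X \<in> Fin" "Y \<in> Fin" "X \<subseteq> Y" for X Y
  proof -
    obtain m where m: "m \<in> alg_hom Sg (A X) (A Y)" "v X = compose (carrier (A X)) (v Y) m"
      using transition[OF XY] by blast
    then show ?thesis using alg_hom_in_carrier[OF m(1)] by (auto simp: compose_eq)
  qed
  define S where "S = (\<Union>X\<in>Fin. v X ` carrier (A X))"
  have S_sub: "S \<subseteq> carrier T" using alg_hom_in_carrier[OF v] unfolding S_def by blast
  \<comment> \<open>Finitarity is used here: an argument list is finite, so directedness puts all
    its entries into a single image. Hence \<open>S\<close> is closed under the operations.\<close>
  have directed: "\<exists>Y\<in>Fin. xs \<in> lists (v Y ` carrier (A Y))" if "xs \<in> lists S" for xs
    using that
  proof (induction xs)
    case Nil
    have "{} \<in> Fin" unfolding Fin_def by simp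
    then show ?case by auto
  next
    case (Cons x xs)
    then obtain X Y where XY: "X \<in> Fin" "Y \<in> Fin" "x \<in> v X ` carrier (A X)"
      "xs \<in> lists (v Y ` carrier (A Y))" unfolding S_def by blast
    have "x \<in> v (X \<union> Y) ` carrier (A (X \<union> Y))"
      using img_mono[of X "X \<union> Y"] Fin_union XY(1-3) by blast
    moreover have "xs \<in> lists (v (X \<union> Y) ` carrier (A (X \<union> Y)))"
      using lists_mono[OF img_mono[of Y "X \<union> Y"]] Fin_union XY(1,2,4) by blast
    ultimately show ?case using Fin_union[OF XY(1,2)] by auto
  qed
  define TS where "TS = T\<lparr>carrier := S\<rparr>"
  have TS_alg: "is_algebra Sg TS"
    unfolding is_algebra_def
  proof (intro ballI impI)
    fix f xs assume f: "f \<in> symbols Sg" "xs \<in> lists (carrier TS)" "length xs = arity Sg f"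
    then have "xs \<in> lists S" unfolding TS_def by simp
    then obtain Y where Y: "Y \<in> Fin" "xs \<in> lists (v Y ` carrier (A Y))"
      using directed by blast
    then obtain ys where ys: "ys \<in> lists (carrier (A Y))" "xs = map (v Y) ys"
      by (auto simp: lists_image)
    have "oper (A Y) f ys \<in> carrier (A Y)"
      using equational_class_imp_algebra[OF V A[OF Y(1)]] f(1,3) ys unfolding is_algebra_def by simp
    moreover have "oper TS f xs = v Y (oper (A Y) f ys)"
      using alg_hom_oper[OF v[OF Y(1)] f(1) ys(1)] f(3) ys(2) unfolding TS_def by simp
    ultimately show "oper TS f xs \<in> carrier TS" using Y(1) unfolding TS_def S_def by auto
  qed
  have TS: "TS \<in> V"
    using equational_class_subalgebra[OF V T(1) S_sub] TS_alg unfolding TS_def by simp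
  define s where "s = restrict (\<lambda>x. x) S"
  have s: "s \<in> alg_hom Sg TS T"
    using alg_hom_subalgebra_inclusion[OF _ S_sub] TS_alg unfolding TS_def s_def by simp
  have vS: "v X \<in> alg_hom Sg (A X) TS" if "X \<in> Fin" for X
    using v[OF that] that unfolding TS_def alg_hom_subalgebra_iff
    by (auto simp: alg_hom_def S_def PiE_iff)
  define gv where "gv X = on_hom G (A X) TS (v X)" for X
  have gv: "gv X \<in> mv_hom (on_ob G (A X)) (on_ob G TS)" if "X \<in> Fin" for X
    using G_hom[OF A TS vS] that unfolding gv_def by simp
  \<comment> \<open>As \<open>v X\<close> already takes values in \<open>S\<close>, it factors
    through the inclusion \<open>s\<close>; applying \<open>G\<close> gives the factorization of
    \<open>\<theta> X\<close>.\<close>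
  have s_gv: "on_hom G TS T s (gv X y) = \<theta> X y" if X: "X \<in> Fin" "y \<in> carrier (on_ob G (A X))" for X y
  proof -
    have "compose (carrier (A X)) s (v X) = v X"
    proof (rule extensionalityI[where A = "carrier (A X)"])
      show "v X \<in> extensional (carrier (A X))" using v[OF X(1)] unfolding alg_hom_def PiE_def by blast
    qed (use X(1) in \<open>auto simp: compose_eq s_def S_def\<close>)
    then show ?thesis
      using G_compose[OF A[OF X(1)] TS T(1) vS[OF X(1)] s X(2)] Gv[OF X(1)] unfolding gv_def by simp
  qed
  have cocone: "gv X (\<eta> X x) = gv Y (\<eta> Y x)"
    if XY: "X \<in> Fin" "Y \<in> Fin" "X \<subseteq> Y" and x: "x \<in> gen X" for X Y x
  proof -
    obtain m where m: "m \<in> alg_hom Sg (A X) (A Y)" "v X = compose (carrier (A X)) (v Y) m"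
      "\<And>x. x \<in> carrier (on_ob G (A X)) \<Longrightarrow> on_hom G (A X) (A Y) m x = \<eta> Y (\<theta> X x)"
      using transition[OF XY] by blast
    show ?thesis
      using G_compose[OF A[OF XY(1)] A[OF XY(2)] TS m(1) vS[OF XY(2)] eta_in[OF XY(1) x]]
        m(3)[OF eta_in[OF XY(1) x]] theta_eta[OF XY(1) x] unfolding gv_def m(2)[symmetric] by simp
  qed
  \<comment> \<open>The maps \<open>gv X\<close> after \<open>\<eta> X\<close> agree on overlaps by
    \<open>cocone\<close>, so they glue to one map on \<open>P\<close>. The singleton
    \<open>{x}\<close> is a canonical choice of index, and \<open>w_eq\<close> allows any
    other.\<close>
  define w where "w = restrict (\<lambda>x. gv {x} (\<eta> {x} x)) (carrier P)"
  have w_eq: "w x = gv X (\<eta> X x)" if X: "X \<in> Fin" "x \<in> gen X" for X x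
  proof -
    have x: "x \<in> carrier P" using gen_carrier X by blast
    then have "{x} \<in> Fin" "x \<in> gen {x}" using gen_ext[of "{x}"] unfolding Fin_def by auto
    then have "gv {x} (\<eta> {x} x) = gv ({x} \<union> X) (\<eta> ({x} \<union> X) x)"
      and "gv X (\<eta> X x) = gv ({x} \<union> X) (\<eta> ({x} \<union> X) x)"
      using cocone[of "{x}" "{x} \<union> X" x] cocone[of X "{x} \<union> X" x] X Fin_union[of "{x}" X] by blast+
    then show ?thesis using x unfolding w_def by simp
  qed
  have w_hom: "w \<in> mv_hom P (on_ob G TS)"
  proof -
    have hom: "gv X (\<eta> X (zer P)) = zer (on_ob G TS)"
      "\<And>x. x \<in> gen X \<Longrightarrow> gv X (\<eta> X x) \<in> carrier (on_ob G TS)"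
      "\<And>x. x \<in> gen X \<Longrightarrow> gv X (\<eta> X (neg P x)) = neg (on_ob G TS) (gv X (\<eta> X x))"
      "\<And>x y. \<lbrakk>x \<in> gen X; y \<in> gen X\<rbrakk> \<Longrightarrow>
        gv X (\<eta> X (oplus P x y)) = oplus (on_ob G TS) (gv X (\<eta> X x)) (gv X (\<eta> X y))"
      if X: "X \<in> Fin" for X
      using eta[OF X] gv[OF X] eta_in[OF X] mv_hom_in_carrier[OF gv[OF X]]
      unfolding mv_hom_def by auto
    \<comment> \<open>Two elements and the results of the operations on them lie in one
      \<open>gen X\<close>, where \<open>w\<close> is a composite of homomorphisms.\<close>
    have "\<exists>X\<in>Fin. x \<in> gen X \<and> y \<in> gen X \<and> zer P \<in> gen X \<and> neg P x \<in> gen X \<and> oplus P x y \<in> gen X"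
      if "x \<in> carrier P" "y \<in> carrier P" for x y
    proof -
      have "{x, y} \<in> Fin" using that unfolding Fin_def by simp
      then show ?thesis using sub[of "{x, y}"] gen_ext[of "{x, y}"] unfolding mv_subalgebra_def by blast
    qed
    then have "\<exists>X\<in>Fin. x \<in> gen X \<and> y \<in> gen X \<and> w x = gv X (\<eta> X x) \<and> w y = gv X (\<eta> X y) \<and>
        w (zer P) = gv X (\<eta> X (zer P)) \<and> w (neg P x) = gv X (\<eta> X (neg P x)) \<and>
        w (oplus P x y) = gv X (\<eta> X (oplus P x y))"
      if "x \<in> carrier P" "y \<in> carrier P" for x y
      using that w_eq by metis
    then have "w (zer P) = zer (on_ob G TS) \<and> w x \<in> carrier (on_ob G TS) \<and>
        w (neg P x) = neg (on_ob G TS) (w x) \<and> w (oplus P x y) = oplus (on_ob G TS) (w x) (w y)"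
      if "x \<in> carrier P" "y \<in> carrier P" for x y
      using that hom by metis
    then show ?thesis
      using mv_algebra_closed(1)[OF P(1)] unfolding mv_hom_def
      by (auto simp: PiE_iff w_def)
  qed
  obtain w' where w': "w' \<in> alg_hom Sg T TS" "on_hom G T TS w' = w"
    using G_full[OF T(1) TS] w_hom unfolding P_def by blast
  \<comment> \<open>On \<open>P\<close>, the map \<open>G s\<close> after \<open>w\<close> is the
    identity, so by faithfulness \<open>w'\<close> is a section of the inclusion \<open>s\<close>.
    Thus \<open>S\<close> is all of \<open>T\<close> and contains the generator.\<close>
  have "compose (carrier T) s w' = restrict (\<lambda>x. x) (carrier T)"
  proof (rule G_faithful[OF T(1) T(1) alg_hom_compose[OF V T(1) TS T(1) w'(1) s] alg_hom_ident[OF V T(1)]])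
    fix x assume x: "x \<in> carrier (on_ob G T)"
    then have X: "{x} \<in> Fin" "x \<in> gen {x}" using gen_ext[of "{x}"] unfolding Fin_def P_def by auto
    have "on_hom G TS T s (w x) = x"
      using w_eq[OF X] s_gv[OF X(1) eta_in[OF X]] theta_eta[OF X] by simp
    then show "on_hom G T T (compose (carrier T) s w') x = on_hom G T T (restrict (\<lambda>x. x) (carrier T)) x"
      using G_compose[OF T(1) TS T(1) w'(1) s x] G_ident[OF T(1) x] w'(2) by simp
  qed
  then have "s (w' (\<iota> u)) = \<iota> u" using T(2) by (metis compose_eq restrict_apply')
  moreover have "w' (\<iota> u) \<in> S" using alg_hom_in_carrier[OF w'(1) T(2)] unfolding TS_def by simp
  ultimately have "\<iota> u \<in> S" unfolding s_def by simp
  then obtain X y where X: "X \<in> Fin" and y: "y \<in> carrier (A X)" "\<iota> u = v X y"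
    unfolding S_def by blast
  \<comment> \<open>The generator lies in the image of a single \<open>v X\<close>. Sending it to a
    preimage gives, by freeness, a section of \<open>v X\<close>, whence \<open>P\<close> is
    contained in the finite \<open>gen X\<close>.\<close>
  obtain h where h: "h \<in> alg_hom Sg T (A X)" "h (\<iota> u) = y"
    using free_over_extend[OF free A[OF X] y(1)] .
  have "compose (carrier T) (v X) h = restrict (\<lambda>x. x) (carrier T)"
    by (rule free_over_unique[OF free T(1) alg_hom_compose[OF V T(1) A[OF X] T(1) h(1) v[OF X]]
          alg_hom_ident[OF V T(1)]]) (use T(2) h(2) y(2) in \<open>simp add: compose_eq\<close>)
  then have "\<theta> X (on_hom G T (A X) h x) = x" if "x \<in> carrier P" for x
    using G_compose[OF T(1) A[OF X] T(1) h(1) v[OF X]] G_ident[OF T(1)] that Gv[OF X]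
    unfolding P_def by simp
  moreover have "on_hom G T (A X) h x \<in> carrier (on_ob G (A X))" if "x \<in> carrier P" for x
    using mv_hom_in_carrier[OF G_hom[OF T(1) A[OF X] h(1)]] that unfolding P_def by simp
  ultimately have "carrier P \<subseteq> gen X" using theta_in[OF X] by (metis subsetI)
  then show ?thesis using gen_finite[OF X] finite_subset unfolding P_def by blast
qed

text \<open>The contradiction comes from a morphism \<open>j\<close> of \<open>V\<close> that is
  bijective on elements, hence invertible, although it corresponds to a proper inclusion.\<close>

lemma no_free:
  assumes free: "free_over Sg V {u} T \<iota>"
  shows False
proof -
  define P where "P = on_ob G T"
  note T = free_over_in_carrier[OF free]
  have P: "P \<in> Ob lfmv_cat" "mv_algebra P" "finite (carrier P)"
    using G_ob[OF T(1)] lfmv_cat_obD(1)[OF G_ob[OF T(1)]] finite_free[OF free]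
    unfolding P_def .
  obtain p where p: "prime p" "card (carrier P) < p" using bigger_prime by blast
  obtain e :: "nat \<Rightarrow> 'u" where e: "inj e" using infinite_countable_subset[OF infinite_universe] by blast
  define L where "L = mv_chain e p"
  define B where "B = {e 0, e p}"
  have L_alg: "mv_algebra L" using mv_algebra_chain[OF e] unfolding L_def .
  have L: "L \<in> Ob lfmv_cat"
    using finite_mv_in_lfmv_cat[OF infinite_universe L_alg] by (simp add: L_def mv_chain_def)
  have sub: "mv_subalgebra L B"
    using e by (auto simp: L_def B_def mv_subalgebra_def mv_chain_def)
  have BL: "B \<subseteq> carrier L" using sub unfolding mv_subalgebra_def by simp
  have LB: "sub_mv L B \<in> Ob lfmv_cat"
    using finite_mv_in_lfmv_cat[OF infinite_universe mv_algebra_sub_mv[OF L_alg sub]] by (simp add: B_def)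
  obtain A \<eta> \<theta> where A: "A \<in> V" and eta: "\<eta> \<in> mv_hom L (on_ob G A)" and theta: "\<theta> \<in> mv_hom (on_ob G A) L"
    and inv: "\<And>x. x \<in> carrier L \<Longrightarrow> \<theta> (\<eta> x) = x" "\<And>y. y \<in> carrier (on_ob G A) \<Longrightarrow> \<eta> (\<theta> y) = y"
    using G_represent[OF L] by blast
  obtain A' \<eta>' \<theta>' where A': "A' \<in> V" and eta': "\<eta>' \<in> mv_hom (sub_mv L B) (on_ob G A')"
    and theta': "\<theta>' \<in> mv_hom (on_ob G A') (sub_mv L B)"
    and inv': "\<And>x. x \<in> B \<Longrightarrow> \<theta>' (\<eta>' x) = x" "\<And>y. y \<in> carrier (on_ob G A') \<Longrightarrow> \<eta>' (\<theta>' y) = y"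
    using G_represent[OF LB] by auto
  note GA = G_ob[OF A] and GA' = G_ob[OF A']
  have theta'_in: "\<theta>' y \<in> B" if "y \<in> carrier (on_ob G A')" for y
    using mv_hom_in_carrier[OF theta' that] by simp
  have "compose (carrier (on_ob G A')) \<eta> \<theta>' \<in> mv_hom (on_ob G A') (on_ob G A)"
    using mv_hom_compose[OF GA' L GA mv_hom_sub_mv_imp[OF theta' BL] eta] .
  \<comment> \<open>Up to the chosen isomorphisms, \<open>G j\<close> is the inclusion of the
    two-element subalgebra \<open>B\<close> into the chain \<open>L\<close>.\<close>
  then obtain j where j: "j \<in> alg_hom Sg A' A"
    and "on_hom G A' A j = compose (carrier (on_ob G A')) \<eta> \<theta>'"
    using G_full[OF A' A] by blast
  then have Gj: "on_hom G A' A j y = \<eta> (\<theta>' y)" if "y \<in> carrier (on_ob G A')" for y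
    using that by (simp add: compose_eq)
  have theta_Gj: "\<theta> (on_hom G A' A j y) = \<theta>' y" if "y \<in> carrier (on_ob G A')" for y
    using Gj[OF that] inv(1) theta'_in[OF that] BL by auto
  \<comment> \<open>Elements of \<open>A'\<close> are named by homomorphisms from \<open>T\<close>,
    and \<open>G j\<close> is injective because \<open>\<theta>\<close> after it is
    \<open>\<theta>'\<close>.\<close>
  have "inj_on j (carrier A')"
  proof (rule inj_onI)
    fix a b assume ab: "a \<in> carrier A'" "b \<in> carrier A'" "j a = j b"
    obtain f where f: "f \<in> alg_hom Sg T A'" "f (\<iota> u) = a" using free_over_extend[OF free A' ab(1)] .
    obtain g where g: "g \<in> alg_hom Sg T A'" "g (\<iota> u) = b" using free_over_extend[OF free A' ab(2)] .
    have "compose (carrier T) j f = compose (carrier T) j g"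
      using free_over_unique[OF free A alg_hom_compose[OF V T(1) A' A f(1) j]
          alg_hom_compose[OF V T(1) A' A g(1) j]] T(2) f(2) g(2) ab(3) by (simp add: compose_eq)
    then have eq: "on_hom G A' A j (on_hom G T A' f x) = on_hom G A' A j (on_hom G T A' g x)"
      if "x \<in> carrier (on_ob G T)" for x
      using G_compose[OF T(1) A' A f(1) j that] G_compose[OF T(1) A' A g(1) j that] by simp
    have "f = g"
    proof (rule G_faithful[OF T(1) A' f(1) g(1)])
      fix x assume x: "x \<in> carrier (on_ob G T)"
      have "on_hom G T A' f x \<in> carrier (on_ob G A')" "on_hom G T A' g x \<in> carrier (on_ob G A')"
        using mv_hom_in_carrier[OF G_hom[OF T(1) A'] x] f(1) g(1) by auto
      then show "on_hom G T A' f x = on_hom G T A' g x"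
        using eq[OF x] theta_Gj inv'(2) by metis
    qed
    then show "a = b" using f(2) g(2) by simp
  qed
  \<comment> \<open>An element \<open>y\<close> is named by \<open>h\<close>, which corresponds to a
    map \<open>f\<close> from \<open>P\<close> to \<open>L\<close>. As \<open>p\<close> is large,
    \<open>f\<close> lands in \<open>B\<close>, so \<open>h\<close> factors through
    \<open>j\<close>.\<close>
  moreover have "carrier A \<subseteq> j ` carrier A'"
  proof
    fix y assume y: "y \<in> carrier A"
    obtain h where h: "h \<in> alg_hom Sg T A" "h (\<iota> u) = y" using free_over_extend[OF free A y] .
    have Gh: "on_hom G T A h \<in> mv_hom P (on_ob G A)" using G_hom[OF T(1) A h(1)] unfolding P_def .
    define f where "f = compose (carrier P) \<theta> (on_hom G T A h)"
    have f: "f \<in> mv_hom P L" using mv_hom_compose[OF P(1) GA L Gh theta] unfolding f_def .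
    have fB: "f ` carrier P \<subseteq> B"
      using mv_hom_to_prime_chain[OF P(2,3) e p(1)] p(2) f unfolding L_def B_def by simp
    have "compose (carrier P) \<eta>' f \<in> mv_hom P (on_ob G A')"
      using mv_hom_compose[OF P(1) LB GA' mv_hom_corestrict[OF f fB] eta'] .
    then obtain k where k: "k \<in> alg_hom Sg T A'" "on_hom G T A' k = compose (carrier P) \<eta>' f"
      using G_full[OF T(1) A'] unfolding P_def by blast
    have "compose (carrier T) j k = h"
    proof (rule G_faithful[OF T(1) A alg_hom_compose[OF V T(1) A' A k(1) j] h(1)])
      fix x assume x: "x \<in> carrier (on_ob G T)"
      then have xP: "x \<in> carrier P" unfolding P_def .
      have fx: "f x \<in> B" using fB xP by blast
      have "\<eta>' (f x) \<in> carrier (on_ob G A')" using mv_hom_in_carrier[OF eta'] fx by simp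
      then have "on_hom G T A (compose (carrier T) j k) x = \<eta> (f x)"
        using G_compose[OF T(1) A' A k(1) j x] k(2) xP Gj inv'(1)[OF fx] by (simp add: compose_eq)
      also have "\<dots> = on_hom G T A h x"
        using inv(2) mv_hom_in_carrier[OF Gh xP] xP unfolding f_def by (simp add: compose_eq)
      finally show "on_hom G T A (compose (carrier T) j k) x = on_hom G T A h x" .
    qed
    then have "y = j (k (\<iota> u))" using h(2) T(2) by (auto simp: compose_eq)
    then show "y \<in> j ` carrier A'" using alg_hom_in_carrier[OF k(1) T(2)] by blast
  qed
  ultimately have bij: "bij_betw j (carrier A') (carrier A)"
    using alg_hom_in_carrier[OF j] unfolding bij_betw_def by blast
  define q where "q = restrict (inv_into (carrier A') j) (carrier A)"
  have q: "q \<in> alg_hom Sg A A'"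
    using alg_hom_inverse[OF equational_class_imp_algebra[OF V A'] j bij] unfolding q_def .
  have "compose (carrier A) j q = restrict (\<lambda>x. x) (carrier A)"
    using bij unfolding q_def compose_def bij_betw_def by (auto simp: f_inv_into_f)
  then have split: "on_hom G A' A j (on_hom G A A' q z) = z" if "z \<in> carrier (on_ob G A)" for z
    using G_compose[OF A A' A q j that] G_ident[OF A that] by simp
  have "p > 1" using p(1) prime_gt_1_nat by blast
  \<comment> \<open>Since \<open>0 < 1 < p\<close>, the element \<open>e 1\<close> is strictly
    between bottom and top.\<close>
  then have e1: "e 1 \<in> carrier L" "e 1 \<notin> B" using e unfolding L_def B_def mv_chain_def by (auto dest: injD)
  have z: "\<eta> (e 1) \<in> carrier (on_ob G A)" using mv_hom_in_carrier[OF eta e1(1)] .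
  have qz: "on_hom G A A' q (\<eta> (e 1)) \<in> carrier (on_ob G A')"
    using mv_hom_in_carrier[OF G_hom[OF A A' q] z] .
  \<comment> \<open>The right inverse of \<open>G j\<close> exhibits \<open>\<eta> (e 1)\<close> as
    a value of \<open>G j\<close>, and \<open>\<theta>\<close> sends every such value into
    \<open>B\<close>.\<close>
  have "e 1 \<in> B" using theta_Gj[OF qz] theta'_in[OF qz] split[OF z] inv(1)[OF e1(1)] by simp
  then show False using e1(2) by simp
qed

end

theorem corollary3p17:
  fixes Sg :: "'f signature" and V :: "('f, 'u) alg set"
  assumes "infinite (UNIV :: 'u set)"
    and "finitary_variety Sg V"
  shows "\<not> equivalent_categories (lfmv_cat :: ('u mv, 'u \<Rightarrow> 'u) cat) (variety_cat Sg V)"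
proof
  assume "equivalent_categories (lfmv_cat :: ('u mv, 'u \<Rightarrow> 'u) cat) (variety_cat Sg V)"
  moreover have V: "equational_class Sg V" using assms(2) unfolding finitary_variety_def by blast
  ultimately obtain G where "is_functor (variety_cat Sg V) (lfmv_cat :: ('u mv, 'u \<Rightarrow> 'u) cat) G"
    and "\<And>a b. \<lbrakk>a \<in> V; b \<in> V\<rbrakk> \<Longrightarrow>
      bij_betw (on_hom G a b) (alg_hom Sg a b) (mv_hom (on_ob G a) (on_ob G b))"
    and "\<And>L :: 'u mv. L \<in> Ob lfmv_cat \<Longrightarrow> \<exists>A\<in>V. \<exists>h. iso_in lfmv_cat L (on_ob G A) h"
    using equivalence_imp_fully_faithful[OF category_lfmv_cat category_variety_cat[OF V]]
    by (auto simp: lfmv_cat_def variety_cat_def)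
  then interpret lfmv_equivalence Sg V G
    using assms(1) V by unfold_locales
  \<comment> \<open>The point \<open>undefined\<close> is merely a label for the single
    generator.\<close>
  have "is_set {undefined :: 'u}" using finite_imp_is_set[OF assms(1)] by simp
  then obtain T \<iota> where "free_over Sg V {undefined :: 'u} T \<iota>"
    using assms(2) unfolding finitary_variety_def by blast
  then show False by (rule no_free)
qed

end
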